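(* Let $f(x)=\sum_{j\ge0}a_jx^j$ be real analytic with $a_j\ge0$ for all $j\ge0$ and radius of convergence $R$. Let $1\le k\le n$ and for an $n\times n$ Hermitian positive definite matrix $A$ with spectrum in $(0,R)$ set $\phi(A)=\prod_{i=1}^k f(\lambda_i(A))$, where $\lambda_1(A)\ge\dots\ge\lambda_n(A)$ are the eigenvalues of $A$. Then $\phi$ is log-g-convex on the set of such matrices, i.e., $\phi(A\#B)\le\sqrt{\phi(A)\phi(B)}$ for all such $A,B$.
   Context: For Hermitian positive definite $A,B$, $A\#B:=A^{1/2}(A^{-1/2}BA^{-1/2})^{1/2}A^{1/2}$ (the matrix geometric mean). *)

theory Defs
  imports "HOL-Analysis.Summation_Tests" "Jordan_Normal_Form.Schur_Decomposition"
    "Jordan_Normal_Form.Char_Poly"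
begin

definition hermitian_mat :: "complex mat \<Rightarrow> bool" where
  "hermitian_mat A \<longleftrightarrow> square_mat A \<and> mat_adjoint A = A"

definition pos_def_mat :: "complex mat \<Rightarrow> bool" where
  "pos_def_mat A \<longleftrightarrow> hermitian_mat A \<and>
     (\<forall>v \<in> carrier_vec (dim_row A). v \<noteq> 0\<^sub>v (dim_row A) \<longrightarrow>
        0 < Re ((A *\<^sub>v v) \<bullet>c v))"

text \<open>The eigenvalues (with algebraic multiplicity) of a square complex matrix:
  the roots of its characteristic polynomial.  For a Hermitian matrix they are real;
  eig_list A lists them (real parts) in non-increasing order, so that
  lambda_i(A) = eig_list A ! (i - 1).\<close>

definition eig_list :: "complex mat \<Rightarrow> real list" where
  "eig_list A = rev (sort (map Re (SOME as. char_poly A = (\<Prod>a\<leftarrow>as. [:- a, 1:])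
                                       \<and> length as = dim_row A)))"

definition mat_sqrt :: "complex mat \<Rightarrow> complex mat" where
  "mat_sqrt A = (THE B. B \<in> carrier_mat (dim_row A) (dim_row A) \<and> pos_def_mat B \<and> B * B = A)"

definition mat_inv :: "complex mat \<Rightarrow> complex mat" where
  "mat_inv A = (THE B. B \<in> carrier_mat (dim_row A) (dim_row A) \<and>
                       A * B = 1\<^sub>m (dim_row A) \<and> B * A = 1\<^sub>m (dim_row A))"

definition geo_mean :: "complex mat \<Rightarrow> complex mat \<Rightarrow> complex mat" where
  "geo_mean A B = (let S = mat_sqrt A; Si = mat_inv S in
                    S * mat_sqrt (Si * B * Si) * S)"

definition pser :: "(nat \<Rightarrow> real) \<Rightarrow> real \<Rightarrow> real" where
  "pser a x = (\<Sum>j. a j * x ^ j)"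

definition phi_k :: "(nat \<Rightarrow> real) \<Rightarrow> nat \<Rightarrow> complex mat \<Rightarrow> real" where
  "phi_k a k A = (\<Prod>i<k. pser a (eig_list A ! i))"

end

theory Submission
  imports Defs "HOL-Analysis.L2_Norm"
begin

text \<open>
  Write $G = A \# B = S M S$ with $S = A^{1/2}$ and $M = (S^{-1} B S^{-1})^{1/2}$, so that $A = S S$
  and $B = S M M S$. If the orthonormal columns of $V$ span the top $m$ eigenvectors of $G$, then with
  $X = S V$, $Y = M S V$ the Cauchy--Schwarz inequality for Gram determinants gives
  $\prod_{i \le m} \lambda_i(G)^2 = |\det X^* Y|^2 \le \det (V^* A V) \det (V^* B V)
    \le \prod_{i \le m} \lambda_i(A) \lambda_i(B)$,
  both inequalities being consequences of the Cauchy--Binet formula. Since $a_j \ge 0$, the function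
  $t \mapsto \ln f(e^t)$ is increasing and convex, so this weak log-majorization passes to the
  products of the values of $f$.
\<close>

section \<open>Power series with non-negative coefficients\<close>

text \<open>Since \<open>S\<close> and \<open>M\<close> are Hermitian, the three Gram products are
  compressions by one and the same \<open>V\<close>: \<open>X^* Y = V^* G V\<close>,
  \<open>X^* X = V^* A V\<close> and \<open>Y^* Y = V^* B V\<close>. The matrices need not commute,
  so eigenvectors of \<open>G\<close> say nothing about those of \<open>A\<close> and
  \<open>B\<close>; a bound that holds for every isometry \<open>V\<close> gets around this. Sums
  over minors take the place of exterior powers. Only inequalities between partial products result,
  which is why the argument about \<open>f\<close> uses its monotonicity besides its convexity.
  Moreover the spectrum of \<open>G\<close> is not assumed to lie inside the radius of convergence;
  the case \<open>m = 1\<close> supplies this. Square root, inverse and eigenvalue list are given by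
  description and choice operators. A spectral theorem with a prescribed order of the eigenvalues
  makes the square root and the eigenvalue list tractable and also yields the bound on
  compressions.\<close>

lemma summable_pser:
  fixes a :: "nat \<Rightarrow> real"
  assumes "0 < x" "ereal x < conv_radius a"
  shows "summable (\<lambda>j. a j * x ^ j)"
  using assms by (intro summable_in_conv_radius) auto

text \<open>Termwise differentiation keeps the radius of convergence; multiplying the differentiated
  series by \<open>x\<close> and shifting its index gives the series here.\<close>

lemma summable_pser_index:
  fixes a :: "nat \<Rightarrow> real"
  assumes x: "0 < x" "ereal x < conv_radius a"
  shows "summable (\<lambda>j. real j * (a j * x ^ j))"
proof -
  obtain K where K: "ereal x < ereal K" "ereal K < conv_radius a"
    using ereal_dense2[OF x(2)] by auto
  have "summable (\<lambda>j. diffs a j * x ^ j)"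
  proof (rule termdiff_converges[where K = K])
    show "norm x < K" using x K by auto
    fix z :: real assume "norm z < K"
    then have "ereal (norm z) < conv_radius a"
      using K(2) by (metis ereal_less(2) less_ereal.simps(1) less_trans)
    then show "summable (\<lambda>j. a j * z ^ j)" by (rule summable_in_conv_radius)
  qed
  then have "summable (\<lambda>j. x * (diffs a j * x ^ j))" by (rule summable_mult)
  then have "summable (\<lambda>j. real (Suc j) * (a (Suc j) * x ^ Suc j))"
    by (simp add: diffs_def mult_ac)
  then show ?thesis by (subst (asm) summable_Suc_iff)
qed

text \<open>This is \<open>x f'(x) / f(x)\<close>, the derivative of
  \<open>t \<mapsto> ln f(e^t)\<close> at \<open>t = ln x\<close>, or the mean of \<open>j\<close>
  under the weights \<open>a j * x ^ j / f(x)\<close>. Written as a quotient of series, it calls for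
  no differentiation of \<open>f\<close>.\<close>

definition pser_slope :: "(nat \<Rightarrow> real) \<Rightarrow> real \<Rightarrow> real" where
  "pser_slope a x = (\<Sum>j. real j * (a j * x ^ j)) / pser a x"

lemma pser_slope_nonneg:
  assumes "\<And>j. 0 \<le> a j" "0 < x" "ereal x < conv_radius a"
  shows "0 \<le> pser_slope a x"
  unfolding pser_slope_def pser_def
  using assms
  by (intro divide_nonneg_nonneg suminf_nonneg summable_pser_index summable_pser) auto

lemma pser_pos:
  assumes "\<And>j. 0 \<le> a j" "0 < a i" "0 < x" "ereal x < conv_radius a"
  shows "0 < pser a x"
  unfolding pser_def using assms
  by (intro suminf_pos2[where i = i] summable_pser) auto

text \<open>Jensen's inequality for the weights $a_j x^j / f(x)$ applied to $j \mapsto (y/x)^j$;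
  it is the tangent inequality of the convex function $t \mapsto \ln f(e^t)$ at $\ln x$.\<close>

lemma ln_pser_tangent:
  assumes a: "\<And>j. 0 \<le> a j" "0 < a i"
    and x: "0 < x" "ereal x < conv_radius a"
    and y: "0 < y" "ereal y < conv_radius a"
  shows "ln (pser a x) + pser_slope a x * (ln y - ln x) \<le> ln (pser a y)"
proof -
  define s where "s = pser_slope a x"
  define l where "l = ln y - ln x"
  define F where "F = pser a x"
  have F: "F > 0" unfolding F_def by (rule pser_pos[OF a x])
  have s: "(\<Sum>j. real j * (a j * x ^ j)) = s * F"
    unfolding s_def F_def pser_slope_def using F[unfolded F_def] by simp
  \<comment> \<open>With \<open>y = x * exp l\<close>, this is the tangent of \<open>exp\<close> at
    the mean exponent \<open>s * l\<close>, evaluated at \<open>j * l\<close> and weighted by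
    \<open>a j * x ^ j\<close>.\<close>
  have summand: "exp (s * l) * (1 - s * l) * (a j * x ^ j) + exp (s * l) * l * (real j * (a j * x ^ j))
      \<le> a j * y ^ j" for j
  proof -
    have "y = x * exp l" unfolding l_def using x y by (simp add: exp_diff)
    then have y_pow: "y ^ j = x ^ j * exp (real j * l)"
      by (simp add: power_mult_distrib exp_of_nat_mult)
    have "exp (s * l) * (1 + (real j * l - s * l)) \<le> exp (s * l) * exp (real j * l - s * l)"
      by (intro mult_left_mono exp_ge_add_one_self) auto
    also have "\<dots> = exp (real j * l)" by (simp add: exp_diff)
    finally have "(exp (s * l) * (1 + (real j * l - s * l))) * (a j * x ^ j)
        \<le> exp (real j * l) * (a j * x ^ j)"
      using a x by (intro mult_right_mono) auto
    then show ?thesis unfolding y_pow by (simp add: algebra_simps)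
  qed
  note sums = summable_mult[OF summable_pser[OF x]] summable_mult[OF summable_pser_index[OF x]]
  \<comment> \<open>The parts linear in \<open>l\<close> cancel in the sum because \<open>s\<close>
    is the weighted mean of \<open>j\<close>.\<close>
  have "exp (s * l) * F = exp (s * l) * (1 - s * l) * F + exp (s * l) * l * (s * F)"
    by (simp add: algebra_simps)
  also have "\<dots> = (\<Sum>j. exp (s * l) * (1 - s * l) * (a j * x ^ j) +
      exp (s * l) * l * (real j * (a j * x ^ j)))"
    unfolding s[symmetric] unfolding F_def pser_def
    by (simp add: suminf_mult suminf_add[symmetric] sums summable_pser[OF x] summable_pser_index[OF x])
  also have "\<dots> \<le> pser a y"
    unfolding pser_def by (intro suminf_le summand summable_add sums summable_pser[OF y])
  finally have "ln (exp (s * l) * F) \<le> ln (pser a y)"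
    using F by (intro ln_mono) auto
  then show ?thesis
    using F by (simp add: ln_mult s_def l_def F_def)
qed

text \<open>Adding the tangent inequality from \<open>x\<close> to \<open>y\<close> and the one from
  \<open>y\<close> to \<open>x\<close> leaves a product of the slope difference with
  \<open>ln y - ln x\<close>; no second derivative enters.\<close>

lemma pser_slope_mono:
  assumes a: "\<And>j. 0 \<le> a j" "0 < a i"
    and x: "0 < x" and xy: "x \<le> y" and y: "ereal y < conv_radius a"
  shows "pser_slope a x \<le> pser_slope a y"
proof (cases "x = y")
  case False
  have x': "ereal x < conv_radius a" using xy y by (meson ereal_less_eq(3) le_less_trans)
  have y': "0 < y" using x xy by simp
  have "(pser_slope a y - pser_slope a x) * (ln y - ln x) \<ge> 0"
    using ln_pser_tangent[OF a x x' y' y] ln_pser_tangent[OF a y' y x x']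
    by (simp add: algebra_simps)
  moreover have "ln y - ln x > 0" using False x xy by simp
  ultimately show ?thesis by (simp add: zero_le_mult_iff)
qed simp

section \<open>From weak log-majorization to products of power series values\<close>

lemma abel_sum_nonneg:
  fixes s d :: "nat \<Rightarrow> real"
  assumes s_nonneg: "\<And>i. i < k \<Longrightarrow> 0 \<le> s i"
    and s_dec: "\<And>i. Suc i < k \<Longrightarrow> s (Suc i) \<le> s i"
    and partial: "\<And>m. m \<le> k \<Longrightarrow> 0 \<le> (\<Sum>i<m. d i)"
  shows "0 \<le> (\<Sum>i<k. s i * d i)"
proof -
  \<comment> \<open>Passing from \<open>s m\<close> to the smaller \<open>s (Suc m)\<close> can only
    lower the left side, because the partial sum of \<open>d\<close> is non-negative; this carries
    the induction.\<close>
  have "m < k \<Longrightarrow> s m * (\<Sum>i<Suc m. d i) \<le> (\<Sum>i<Suc m. s i * d i)" for m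
  proof (induction m)
    case (Suc m)
    have "s (Suc m) * (\<Sum>i<Suc m. d i) \<le> s m * (\<Sum>i<Suc m. d i)"
      using Suc.prems by (intro mult_right_mono s_dec partial) auto
    with Suc show ?case by (simp add: algebra_simps)
  qed simp
  from this[of "k - 1"] show ?thesis
    using s_nonneg[of "k - 1"] partial[of k] by (cases k) (auto intro: order_trans[rotated])
qed

text \<open>Weyl's majorization argument for $t \mapsto \ln f(e^t)$: the tangent slopes at \<open>g i\<close> are
  non-negative and decreasing in \<open>i\<close>, so Abel summation applies to the logarithms of the
  partial products.\<close>

lemma prod_pser_le_sqrt:
  fixes a g \<alpha> \<beta> :: "nat \<Rightarrow> real"
  assumes a: "\<And>j. 0 \<le> a j" and k: "1 \<le> k"
    and g: "\<And>i. i < k \<Longrightarrow> 0 < g i" "\<And>i. Suc i < k \<Longrightarrow> g (Suc i) \<le> g i"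
    and \<alpha>: "\<And>i. i < k \<Longrightarrow> 0 < \<alpha> i \<and> ereal (\<alpha> i) < conv_radius a"
    and \<beta>: "\<And>i. i < k \<Longrightarrow> 0 < \<beta> i \<and> ereal (\<beta> i) < conv_radius a"
    and maj: "\<And>m. m \<le> k \<Longrightarrow> (\<Prod>i<m. g i)\<^sup>2 \<le> (\<Prod>i<m. \<alpha> i) * (\<Prod>i<m. \<beta> i)"
  shows "(\<Prod>i<k. pser a (g i)) \<le> sqrt ((\<Prod>i<k. pser a (\<alpha> i)) * (\<Prod>i<k. pser a (\<beta> i)))"
proof (cases "\<exists>i. 0 < a i")
  \<comment> \<open>Logarithms need positive values of the series. If all coefficients vanish, both
    products are zero, being non-empty by \<open>k\<close>.\<close>
  case False
  then have "a i = 0" for i using a[of i] by (metis order_le_less)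
  then have "pser a x = 0" for x by (simp add: pser_def)
  then show ?thesis using k by auto
next
  case True
  then obtain i0 where i0: "0 < a i0" by blast
  \<comment> \<open>The largest \<open>g i\<close> is \<open>g 0\<close>, and \<open>maj\<close> at
    \<open>m = 1\<close> bounds it by the larger of \<open>\<alpha> 0\<close> and
    \<open>\<beta> 0\<close>. Hence the series converges at every \<open>g i\<close>.\<close>
  have g_le0: "g i \<le> g 0" if "i < k" for i
    using that by (induction i) (auto intro: order_trans g(2))
  have "(g 0)\<^sup>2 \<le> \<alpha> 0 * \<beta> 0" using maj[of 1] k by simp
  also have "\<dots> \<le> (max (\<alpha> 0) (\<beta> 0))\<^sup>2"
    unfolding power2_eq_square using \<alpha>[of 0] \<beta>[of 0] k by (intro mult_mono) auto
  finally have "g 0 \<le> max (\<alpha> 0) (\<beta> 0)"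
    using \<alpha>[of 0] k by - (rule power2_le_imp_le, auto)
  moreover have "ereal (max (\<alpha> 0) (\<beta> 0)) < conv_radius a"
    using \<alpha>[of 0] \<beta>[of 0] k by (simp add: max_def)
  ultimately have gR: "ereal (g i) < conv_radius a" if "i < k" for i
    using g_le0[OF that] by (meson ereal_less_eq(3) le_less_trans order_trans)
  define d where "d i = (ln (\<alpha> i) + ln (\<beta> i)) / 2 - ln (g i)" for i
  have partial: "0 \<le> (\<Sum>i<m. d i)" if m: "m \<le> k" for m
  proof -
    have pos: "(\<Prod>i<m. g i) > 0" "(\<Prod>i<m. \<alpha> i) > 0" "(\<Prod>i<m. \<beta> i) > 0"
      using m g \<alpha> \<beta> by (auto intro!: prod_pos)
    have "ln ((\<Prod>i<m. g i)\<^sup>2) \<le> ln ((\<Prod>i<m. \<alpha> i) * (\<Prod>i<m. \<beta> i))"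
      by (intro ln_mono maj[OF m] zero_less_power pos mult_pos_pos)
    then have "2 * ln (\<Prod>i<m. g i) \<le> ln (\<Prod>i<m. \<alpha> i) + ln (\<Prod>i<m. \<beta> i)"
      using pos by (simp add: ln_mult_pos power2_eq_square)
    moreover have nz: "g i \<noteq> 0" "\<alpha> i \<noteq> 0" "\<beta> i \<noteq> 0" if "i < m" for i
      using that m g(1)[of i] \<alpha>[of i] \<beta>[of i] by auto
    then have "ln (\<Prod>i<m. g i) = (\<Sum>i<m. ln (g i))" "ln (\<Prod>i<m. \<alpha> i) = (\<Sum>i<m. ln (\<alpha> i))"
      "ln (\<Prod>i<m. \<beta> i) = (\<Sum>i<m. ln (\<beta> i))"
      by (auto intro!: ln_prod)
    ultimately show ?thesis
      by (simp add: d_def sum_subtractf sum.distrib sum_divide_distrib[symmetric])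
  qed
  have pos: "0 < pser a (g i)" "0 < pser a (\<alpha> i)" "0 < pser a (\<beta> i)" if "i < k" for i
    using that g \<alpha> \<beta> gR by (auto intro!: pser_pos[of a i0, OF a i0])
  have ln_prod_pser: "ln (\<Prod>i<k. pser a (h i)) = (\<Sum>i<k. ln (pser a (h i)))"
    if "\<And>i. i < k \<Longrightarrow> 0 < pser a (h i)" for h :: "nat \<Rightarrow> real"
    using that by (intro ln_prod) (auto simp: less_imp_neq[symmetric])
  have "0 \<le> (\<Sum>i<k. pser_slope a (g i) * d i)"
    using g gR by (intro abel_sum_nonneg partial pser_slope_mono[of a i0, OF a i0] pser_slope_nonneg[of a, OF a])
      (auto dest: Suc_lessD)
  \<comment> \<open>Each term is the average of the tangent inequalities from \<open>g i\<close> to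
    \<open>\<alpha> i\<close> and from \<open>g i\<close> to \<open>\<beta> i\<close>.\<close>
  also have "\<dots> \<le> (\<Sum>i<k. (ln (pser a (\<alpha> i)) + ln (pser a (\<beta> i))) / 2 - ln (pser a (g i)))"
  proof (intro sum_mono)
    fix i assume "i \<in> {..<k}"
    then have i: "i < k" by simp
    show "pser_slope a (g i) * d i
        \<le> (ln (pser a (\<alpha> i)) + ln (pser a (\<beta> i))) / 2 - ln (pser a (g i))"
      using ln_pser_tangent[of a i0 "g i" "\<alpha> i", OF a i0 g(1)[OF i] gR[OF i]] \<alpha>[OF i]
        ln_pser_tangent[of a i0 "g i" "\<beta> i", OF a i0 g(1)[OF i] gR[OF i]] \<beta>[OF i]
      by (simp add: d_def field_simps)
  qed
  also have "\<dots> = (ln (\<Prod>i<k. pser a (\<alpha> i)) + ln (\<Prod>i<k. pser a (\<beta> i))) / 2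
      - ln (\<Prod>i<k. pser a (g i))"
    using pos
    by (simp add: ln_prod_pser sum_subtractf sum.distrib sum_divide_distrib[symmetric])
  finally have le: "2 * ln (\<Prod>i<k. pser a (g i))
      \<le> ln (\<Prod>i<k. pser a (\<alpha> i)) + ln (\<Prod>i<k. pser a (\<beta> i))"
    by simp
  have prods: "0 < (\<Prod>i<k. pser a (g i))" "0 < (\<Prod>i<k. pser a (\<alpha> i))"
    "0 < (\<Prod>i<k. pser a (\<beta> i))"
    using pos by (auto intro!: prod_pos)
  note P = mult_pos_pos[OF prods(2,3)]
  have "ln (\<Prod>i<k. pser a (g i)) \<le> ln (sqrt ((\<Prod>i<k. pser a (\<alpha> i)) * (\<Prod>i<k. pser a (\<beta> i))))"
    unfolding ln_sqrt[OF less_imp_le[OF P]] ln_mult_pos[OF prods(2,3)] using le by simp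
  then show ?thesis
    using prods(1) P by (subst (asm) ln_le_cancel_iff) simp_all
qed

section \<open>Gram determinants\<close>

lemma adjoint_dim [simp]:
  "dim_row (mat_adjoint A) = dim_col A" "dim_col (mat_adjoint A) = dim_row A"
  by (auto simp: mat_adjoint_def)

lemma adjoint_carrier [simp]: "A \<in> carrier_mat n m \<Longrightarrow> mat_adjoint A \<in> carrier_mat m n"
  by (intro carrier_matI) auto

lemma adjoint_index [simp]:
  fixes A :: "complex mat"
  shows "i < dim_col A \<Longrightarrow> j < dim_row A \<Longrightarrow> mat_adjoint A $$ (i, j) = cnj (A $$ (j, i))"
  by (simp add: mat_adjoint_def mat_of_rows_def)

text \<open>The selected rows \<open>f 0, \<dots>, f (m - 1)\<close> may repeat or be out of order.\<close>

definition row_minor :: "nat \<Rightarrow> 'a :: comm_ring_1 mat \<Rightarrow> (nat \<Rightarrow> nat) \<Rightarrow> 'a" where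
  "row_minor m X f = det (mat m m (\<lambda>(i, j). X $$ (f i, j)))"

lemma row_minor_leibniz:
  "row_minor m X f = (\<Sum>p | p permutes {0..<m}. signof p * (\<Prod>i = 0..<m. X $$ (f i, p i)))"
  unfolding row_minor_def
  by (subst det_def'[of _ m]; (intro sum.cong refl arg_cong2[where f = "(*)"] prod.cong)?)
    (auto simp: permutes_nat_less)

lemma row_minor_not_inj:
  assumes "\<not> inj_on f {0..<m}"
  shows "row_minor m X f = 0"
proof -
  obtain i j where "i < m" "j < m" "i \<noteq> j" "f i = f j"
    using assms by (auto simp: inj_on_def)
  then show ?thesis
    unfolding row_minor_def by (intro det_identical_rows[of _ m i j]) (auto intro!: eq_vecI)
qed

text \<open>The Cauchy--Binet formula, with the sum over increasing row selections replaced by a sum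
  over all of them, so that each \<open>m\<close>-set of rows is counted \<open>m!\<close> times.\<close>

lemma cauchy_binet:
  fixes X Y :: "'a :: comm_ring_1 mat"
  assumes X: "X \<in> carrier_mat n m" and Y: "Y \<in> carrier_mat n m"
  shows "of_nat (fact m) * det (transpose_mat X * Y)
    = (\<Sum>f \<in> {0..<m} \<rightarrow>\<^sub>E {0..<n}. row_minor m X f * row_minor m Y f)"
proof -
  let ?P = "{p. p permutes {0..<m}}" and ?F = "{0..<m} \<rightarrow>\<^sub>E {0..<n}"
  let ?s = "signof :: _ \<Rightarrow> 'a"
  define M where "M = transpose_mat X * Y"
  have M: "M \<in> carrier_mat m m" using X Y by (auto simp: M_def)
  have M_index: "M $$ (i, j) = (\<Sum>l = 0..<n. X $$ (l, i) * Y $$ (l, j))" if "i < m" "j < m" for i j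
    using that X Y by (simp add: M_def scalar_prod_def)
  have fin: "finite ?P" by (rule finite_permutations) simp
  have "(\<Sum>f \<in> ?F. row_minor m X f * row_minor m Y f)
      = (\<Sum>f \<in> ?F. \<Sum>p \<in> ?P. \<Sum>q \<in> ?P. ?s p * ?s q *
          (\<Prod>i = 0..<m. X $$ (f i, p i) * Y $$ (f i, q i)))"
    unfolding row_minor_leibniz sum_product prod.distrib by (simp only: mult_ac)
  also have "\<dots> = (\<Sum>p \<in> ?P. \<Sum>q \<in> ?P. ?s p * ?s q *
      (\<Sum>f \<in> ?F. \<Prod>i = 0..<m. X $$ (f i, p i) * Y $$ (f i, q i)))"
    unfolding sum_distrib_left
    by (subst sum.swap, rule sum.cong[OF refl], subst sum.swap, rule refl)
  \<comment> \<open>As \<open>f\<close> ranges over all selections, the distributive law turns the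
    sum over \<open>f\<close> of products into a product of sums, and these sums are entries of
    \<open>M\<close>.\<close>
  also have "\<dots> = (\<Sum>p \<in> ?P. \<Sum>q \<in> ?P. ?s p * ?s q * (\<Prod>i = 0..<m. M $$ (p i, q i)))"
  proof (intro sum.cong refl arg_cong2[where f = "(*)"])
    fix p q assume "p \<in> ?P" "q \<in> ?P"
    then have "(\<Prod>i = 0..<m. M $$ (p i, q i))
        = (\<Prod>i = 0..<m. \<Sum>l = 0..<n. X $$ (l, p i) * Y $$ (l, q i))"
      by (intro prod.cong refl M_index) (auto simp: permutes_nat_less)
    then show "(\<Sum>f \<in> ?F. \<Prod>i = 0..<m. X $$ (f i, p i) * Y $$ (f i, q i))
        = (\<Prod>i = 0..<m. M $$ (p i, q i))"
      by (simp add: prod_sum_PiE)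
  qed
  \<comment> \<open>For fixed \<open>p\<close>, the sum over \<open>q\<close> is the Leibniz
    expansion of \<open>M\<close> with its rows permuted by \<open>p\<close>. The sign of
    \<open>p\<close> occurs twice and cancels.\<close>
  also have "\<dots> = (\<Sum>p \<in> ?P. det M)"
  proof (intro sum.cong refl)
    fix p assume p: "p \<in> ?P"
    then have p': "p permutes {0..<m}" by simp
    have "det (mat m m (\<lambda>(i, j). M $$ (p i, j))) = ?s p * det M"
      using det_permute_rows[OF M p'] by simp
    moreover have "det (mat m m (\<lambda>(i, j). M $$ (p i, j)))
        = (\<Sum>q \<in> ?P. ?s q * (\<Prod>i = 0..<m. M $$ (p i, q i)))"
      by (subst det_def'[of _ m]; (intro sum.cong refl arg_cong2[where f = "(*)"] prod.cong)?)
    (auto simp: permutes_nat_less)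
    ultimately have "(\<Sum>q \<in> ?P. ?s p * ?s q * (\<Prod>i = 0..<m. M $$ (p i, q i)))
        = ?s p * (?s p * det M)"
      by (simp add: sum_distrib_left[symmetric] mult.assoc)
    also have "\<dots> = det M"
      by (simp add: sign_def)
    finally show "(\<Sum>q \<in> ?P. ?s p * ?s q * (\<Prod>i = 0..<m. M $$ (p i, q i))) = det M" .
  qed
  also have "\<dots> = of_nat (fact m) * det M"
    using card_permutations[of "{0..<m}" m] by simp
  finally show ?thesis by (simp add: M_def)
qed

lemma cauchy_binet_adjoint:
  fixes X Y :: "complex mat"
  assumes X: "X \<in> carrier_mat n m" and Y: "Y \<in> carrier_mat n m"
  shows "fact m * det (mat_adjoint X * Y)
    = (\<Sum>f \<in> {0..<m} \<rightarrow>\<^sub>E {0..<n}. cnj (row_minor m X f) * row_minor m Y f)"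
proof -
  let ?X = "map_mat cnj X"
  have "mat_adjoint X = transpose_mat ?X"
    using X by (intro eq_matI) auto
  moreover have "row_minor m ?X f = cnj (row_minor m X f)" if f: "f \<in> {0..<m} \<rightarrow>\<^sub>E {0..<n}" for f
  proof -
    have "?X $$ (f i, p i) = cnj (X $$ (f i, p i))" if "i < m" "p permutes {0..<m}" for i p
      using f X that by (auto simp: permutes_nat_less PiE_iff)
    then show ?thesis
      unfolding row_minor_leibniz cnj_sum by (intro sum.cong refl) (simp add: sign_def)
  qed
  ultimately show ?thesis
    using cauchy_binet[of ?X n m Y] X Y by (simp cong: sum.cong)
qed

lemma det_gram:
  fixes X :: "complex mat"
  assumes X: "X \<in> carrier_mat n m"
  shows "fact m * Re (det (mat_adjoint X * X))
    = (\<Sum>f \<in> {0..<m} \<rightarrow>\<^sub>E {0..<n}. (cmod (row_minor m X f))\<^sup>2)"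
proof -
  have "complex_of_real (fact m) * det (mat_adjoint X * X)
      = of_real (\<Sum>f \<in> {0..<m} \<rightarrow>\<^sub>E {0..<n}. (cmod (row_minor m X f))\<^sup>2)"
    using cauchy_binet_adjoint[OF X X]
    by (simp add: complex_norm_square mult.commute del: of_real_power)
  from arg_cong[OF this, of Re] show ?thesis by simp
qed

lemma det_gram_nonneg:
  fixes X :: "complex mat"
  assumes X: "X \<in> carrier_mat n m"
  shows "0 \<le> Re (det (mat_adjoint X * X))"
proof -
  have "0 \<le> fact m * Re (det (mat_adjoint X * X))"
    unfolding det_gram[OF X] by (intro sum_nonneg) auto
  then show ?thesis
    using fact_gt_zero[of m, where 'a = real] by (auto simp: zero_le_mult_iff simp del: fact_gt_zero)
qed

text \<open>Up to the factor \<open>fact m\<close>, the three determinants are the inner product and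
  the two squared norms of the vectors of all minors of \<open>X\<close> and \<open>Y\<close>. The
  ordinary Cauchy--Schwarz inequality applies, and the factor cancels.\<close>

lemma det_cauchy_schwarz:
  fixes X Y :: "complex mat"
  assumes X: "X \<in> carrier_mat n m" and Y: "Y \<in> carrier_mat n m"
  shows "(cmod (det (mat_adjoint X * Y)))\<^sup>2
    \<le> Re (det (mat_adjoint X * X)) * Re (det (mat_adjoint Y * Y))"
proof -
  let ?F = "{0..<m} \<rightarrow>\<^sub>E {0..<n}"
  let ?x = "\<lambda>f. cmod (row_minor m X f)" and ?y = "\<lambda>f. cmod (row_minor m Y f)"
  have "fact m * cmod (det (mat_adjoint X * Y)) = cmod (fact m * det (mat_adjoint X * Y))"
    by (simp add: norm_mult)
  also have "\<dots> \<le> (\<Sum>f \<in> ?F. ?x f * ?y f)"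
    unfolding cauchy_binet_adjoint[OF X Y] by (rule sum_norm_le) (simp add: norm_mult)
  also have "\<dots> \<le> L2_set ?x ?F * L2_set ?y ?F"
    using L2_set_mult_ineq[of ?x ?y ?F] by simp
  finally have "(fact m * cmod (det (mat_adjoint X * Y)))\<^sup>2 \<le> (L2_set ?x ?F * L2_set ?y ?F)\<^sup>2"
    by (intro power_mono) auto
  also have "\<dots> = (\<Sum>f \<in> ?F. (?x f)\<^sup>2) * (\<Sum>f \<in> ?F. (?y f)\<^sup>2)"
    unfolding L2_set_def power_mult_distrib by (simp add: sum_nonneg)
  also have "\<dots> = (fact m)\<^sup>2 * (Re (det (mat_adjoint X * X)) * Re (det (mat_adjoint Y * Y)))"
    unfolding det_gram[OF X, symmetric] det_gram[OF Y, symmetric] by (simp add: power2_eq_square)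
  finally show ?thesis by (simp add: power_mult_distrib)
qed

section \<open>Determinants of compressions of a diagonal matrix\<close>

lemma prod_subset_le_initial:
  fixes l :: "nat \<Rightarrow> real"
  assumes l_pos: "\<And>i. i < n \<Longrightarrow> 0 < l i"
    and l_dec: "\<And>i j. i \<le> j \<Longrightarrow> j < n \<Longrightarrow> l j \<le> l i"
    and S: "S \<subseteq> {..<n}"
  shows "(\<Prod>i \<in> S. l i) \<le> (\<Prod>i < card S. l i)"
proof -
  have "finite S" using S finite_subset by blast
  then show ?thesis using S
  proof (induction "card S" arbitrary: S)
    case (Suc c)
    \<comment> \<open>The largest index is split off: a set of \<open>Suc c\<close> naturals has
      maximum at least \<open>c\<close>, so \<open>l M\<close> is at most the last factor
      \<open>l c\<close> of the initial product.\<close>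
    define M where "M = Max S"
    have "S \<noteq> {}" using Suc by auto
    then have M: "M \<in> S" "\<forall>i \<in> S. i \<le> M" using Suc by (auto simp: M_def)
    have "card S \<le> card {..M}" using M by (intro card_mono) auto
    then have c: "c \<le> M" using Suc by simp
    have card: "card (S - {M}) = c" using Suc M by simp
    have IH: "(\<Prod>i \<in> S - {M}. l i) \<le> (\<Prod>i < card (S - {M}). l i)"
      using Suc card by (intro Suc.hyps(1)) auto
    have "l M * (\<Prod>i \<in> S - {M}. l i) \<le> l c * (\<Prod>i < c. l i)"
    proof (rule mult_mono)
      show "(\<Prod>i \<in> S - {M}. l i) \<le> (\<Prod>i < c. l i)" using IH card by simp
      show "l M \<le> l c" using c M Suc.prems by (intro l_dec) auto
      show "0 \<le> l c" using c M Suc.prems by (intro less_imp_le l_pos) auto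
      show "0 \<le> (\<Prod>i \<in> S - {M}. l i)"
        using Suc.prems by (intro prod_nonneg) (auto intro!: less_imp_le l_pos)
    qed
    moreover have "(\<Prod>i \<in> S. l i) = l M * (\<Prod>i \<in> S - {M}. l i)"
      using M Suc.prems by (intro prod.remove) auto
    moreover have "(\<Prod>i < card S. l i) = l c * (\<Prod>i < c. l i)"
      unfolding Suc.hyps(2)[symmetric] by (simp add: mult.commute)
    ultimately show ?case by simp
  qed auto
qed

text \<open>A diagonal factor multiplies each minor by the selected \<open>l\<close>-values. By
  Cauchy--Binet the determinant is thus an average of products of \<open>l\<close>-values, weighted
  by the squared moduli of the minors of \<open>W\<close>; these weights sum to
  \<open>fact m\<close> because \<open>W\<close> is an isometry.\<close>

lemma det_compression_diag_le:
  fixes W :: "complex mat" and l :: "nat \<Rightarrow> real"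
  assumes W: "W \<in> carrier_mat n m" and iso: "mat_adjoint W * W = 1\<^sub>m m"
    and l_pos: "\<And>i. i < n \<Longrightarrow> 0 < l i"
    and l_dec: "\<And>i j. i \<le> j \<Longrightarrow> j < n \<Longrightarrow> l j \<le> l i"
  shows "Re (det (mat_adjoint W * (mat_diag n (\<lambda>i. of_real (l i)) * W))) \<le> (\<Prod>i<m. l i)"
proof -
  let ?F = "{0..<m} \<rightarrow>\<^sub>E {0..<n}"
  let ?D = "mat_diag n (\<lambda>i. complex_of_real (l i))"
  have DW: "?D * W \<in> carrier_mat n m" using W by (intro mult_carrier_mat[of _ n n]) auto
  have minor: "row_minor m (?D * W) f = of_real (\<Prod>i = 0..<m. l (f i)) * row_minor m W f"
    if f: "f \<in> ?F" for f
  proof -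
    have "(?D * W) $$ (f i, p i) = of_real (l (f i)) * W $$ (f i, p i)"
      if "i < m" "p permutes {0..<m}" for i p
      using that f W by (auto simp: mat_diag_mult_left permutes_nat_less PiE_iff)
    then show ?thesis
      unfolding row_minor_leibniz by (simp add: sum_distrib_left prod.distrib mult_ac)
  qed
  have "complex_of_real (fact m) * det (mat_adjoint W * (?D * W))
      = of_real (\<Sum>f \<in> ?F. (\<Prod>i = 0..<m. l (f i)) * (cmod (row_minor m W f))\<^sup>2)"
    using cauchy_binet_adjoint[OF W DW]
    by (simp add: minor complex_norm_square mult_ac cong: sum.cong del: of_real_power)
  from arg_cong[OF this, of Re]
  have "fact m * Re (det (mat_adjoint W * (?D * W)))
      = (\<Sum>f \<in> ?F. (\<Prod>i = 0..<m. l (f i)) * (cmod (row_minor m W f))\<^sup>2)"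
    by (simp del: of_real_prod of_real_sum of_real_mult of_real_power)
  also have "\<dots> \<le> (\<Sum>f \<in> ?F. (\<Prod>i<m. l i) * (cmod (row_minor m W f))\<^sup>2)"
  proof (intro sum_mono)
    fix f assume f: "f \<in> ?F"
    show "(\<Prod>i = 0..<m. l (f i)) * (cmod (row_minor m W f))\<^sup>2
        \<le> (\<Prod>i<m. l i) * (cmod (row_minor m W f))\<^sup>2"
    \<comment> \<open>With repeated rows the product of \<open>l\<close>-values may exceed the
      bound, but the minor is then zero.\<close>
    proof (cases "inj_on f {0..<m}")
      case True
      have "(\<Prod>i = 0..<m. l (f i)) = (\<Prod>i \<in> f ` {0..<m}. l i)"
        using True by (simp add: prod.reindex)
      also have "\<dots> \<le> (\<Prod>i < card (f ` {0..<m}). l i)"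
        using f by (intro prod_subset_le_initial[of n] l_pos l_dec) (auto simp: PiE_iff)
      finally show ?thesis using True by (simp add: card_image mult_right_mono)
    qed (simp add: row_minor_not_inj)
  qed
  also have "\<dots> = (\<Prod>i<m. l i) * (fact m * Re (det (mat_adjoint W * W)))"
    unfolding det_gram[OF W] by (rule sum_distrib_left[symmetric])
  also have "\<dots> = fact m * (\<Prod>i<m. l i)" by (simp add: iso)
  finally show ?thesis by simp
qed

section \<open>Diagonalization of Hermitian matrices\<close>

lemma adjoint_adjoint [simp]: "mat_adjoint (mat_adjoint A) = (A :: complex mat)"
  by (intro eq_matI) auto

lemma adjoint_mult:
  fixes A B :: "complex mat"
  assumes "A \<in> carrier_mat n m" "B \<in> carrier_mat m p"
  shows "mat_adjoint (A * B) = mat_adjoint B * mat_adjoint A"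
  using assms by (intro eq_matI) (auto simp: scalar_prod_def mult.commute)

text \<open>The inner dimensions do not occur in the conclusions of the general rules; fixing all of
  them to \<open>n\<close> lets rewriting discharge the carrier conditions.\<close>

lemmas square_mat_simps = mult_carrier_mat[of _ n n _ n] assoc_mult_mat[of _ n n _ n _ n]
  adjoint_mult[of _ n n _ n] for n

lemma adjoint_diag:
  "mat_adjoint (mat_diag n (\<lambda>i. complex_of_real (d i))) = mat_diag n (\<lambda>i. of_real (d i))"
  by (intro eq_matI) (auto simp: mat_diag_def)

lemma mult_block_diag:
  fixes A A' D D' :: "complex mat"
  assumes "A \<in> carrier_mat p p" "A' \<in> carrier_mat p p" "D \<in> carrier_mat q q" "D' \<in> carrier_mat q q"
  shows "four_block_mat A (0\<^sub>m p q) (0\<^sub>m q p) D * four_block_mat A' (0\<^sub>m p q) (0\<^sub>m q p) D'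
    = four_block_mat (A * A') (0\<^sub>m p q) (0\<^sub>m q p) (D * D')"
  using assms by (subst mult_four_block_mat[where ?nr1.0 = p and ?n1.0 = p and ?nc1.0 = p
    and ?nr2.0 = q and ?n2.0 = q and ?nc2.0 = q]) auto

lemma cscalar_prod_self:
  fixes w :: "complex vec"
  shows "w \<bullet>c w = of_real (\<Sum>i<dim_vec w. (cmod (w $ i))\<^sup>2)"
  by (simp add: scalar_prod_def complex_norm_square lessThan_atLeast0 del: of_real_power)

text \<open>Gram--Schmidt applied to a basis starting with \<open>v\<close> leaves \<open>v\<close>
  in first place, and normalizing the orthogonal vectors only rescales it; \<open>c\<close> is this
  scaling factor.\<close>

lemma unitary_with_first_column:
  fixes v :: "complex vec"
  assumes v: "v \<in> carrier_vec n" "v \<noteq> 0\<^sub>v n"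
  shows "\<exists>W c. W \<in> carrier_mat n n \<and> mat_adjoint W * W = 1\<^sub>m n \<and> col W 0 = c \<cdot>\<^sub>v v"
proof -
  interpret cof_vec_space n "TYPE(complex)" .
  have n: "n \<noteq> 0" using v by (auto simp: vec_eq_iff)
  define b where "b = basis_completion v"
  define ws where "ws = gram_schmidt n b"
  note b = basis_completion[OF v, folded b_def]
  obtain vs where bv: "b = v # vs" using b(6,7) n by (cases b) auto
  from gram_schmidt_result[OF b(2,4,5) refl, folded ws_def]
  have ws: "set ws \<subseteq> carrier_vec n" "corthogonal ws" "length ws = n"
    by (auto simp: b)
  have "hd ws = v" using gram_schmidt_hd[OF v(1), of vs, folded bv] unfolding ws_def .
  then have ws0: "ws ! 0 = v" using ws n by (subst hd_conv_nth[symmetric]) auto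
  have ws_dim: "ws ! j \<in> carrier_vec n" if "j < n" for j
    using that ws nth_mem by blast
  define r where "r w = complex_of_real (1 / sqrt (Re (w \<bullet>c w)))" for w :: "complex vec"
  have cnj_r: "cnj (r w) = r w" for w by (simp add: r_def)
  define W where "W = mat n n (\<lambda>(i, j). r (ws ! j) * ws ! j $ i)"
  have W: "W \<in> carrier_mat n n" by (simp add: W_def)
  have "mat_adjoint W * W = 1\<^sub>m n"
  proof (rule eq_matI)
    fix i j assume ij: "i < dim_row (1\<^sub>m n :: complex mat)" "j < dim_col (1\<^sub>m n :: complex mat)"
    have "(mat_adjoint W * W) $$ (i, j) = (\<Sum>l = 0..<n. cnj (W $$ (l, i)) * W $$ (l, j))"
      using ij W by (simp add: scalar_prod_def)
    also have "\<dots> = r (ws ! i) * r (ws ! j) * (\<Sum>l = 0..<n. ws ! j $ l * cnj (ws ! i $ l))"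
      using ij by (simp add: W_def sum_distrib_left cnj_r mult_ac)
    also have "(\<Sum>l = 0..<n. ws ! j $ l * cnj (ws ! i $ l)) = ws ! j \<bullet>c ws ! i"
      using ij ws_dim[of i] by (simp add: scalar_prod_def)
    also have "r (ws ! i) * r (ws ! j) * (ws ! j \<bullet>c ws ! i) = 1\<^sub>m n $$ (i, j)"
    proof (cases "i = j")
      case False
      then show ?thesis using ij corthogonalD[OF ws(2), of j i] ws(3) by simp
    next
      case True
      define N where "N = (\<Sum>l<dim_vec (ws ! j). (cmod (ws ! j $ l))\<^sup>2)"
      have N: "ws ! j \<bullet>c ws ! j = of_real N" by (simp add: cscalar_prod_self N_def)
      moreover have "ws ! j \<bullet>c ws ! j \<noteq> 0"
        using ij corthogonalD[OF ws(2), of j j] ws(3) by simp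
      moreover have "N \<ge> 0" unfolding N_def by (intro sum_nonneg) auto
      ultimately have "N > 0" by (cases "N = 0") auto
      then have "1 / sqrt N * (1 / sqrt N) * N = 1" by (simp add: field_simps)
      then have "r (ws ! j) * r (ws ! j) * of_real N = 1"
        unfolding r_def N by (simp flip: of_real_mult)
      then show ?thesis using True ij N by simp
    qed
    finally show "(mat_adjoint W * W) $$ (i, j) = 1\<^sub>m n $$ (i, j)" .
  qed (use W in auto)
  moreover have "col W 0 = r v \<cdot>\<^sub>v v"
    using n v by (intro eq_vecI) (auto simp: W_def ws0)
  ultimately show ?thesis using W by blast
qed

text \<open>Deflation, one linear factor at a time. The list \<open>es\<close> may be in any order,
  and the diagonal follows that order, so a sorted list gives a sorted diagonal.\<close>

lemma hermitian_diagonalize: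
  fixes A :: "complex mat"
  assumes "A \<in> carrier_mat n n" "mat_adjoint A = A" "char_poly A = (\<Prod>e\<leftarrow>es. [:- e, 1:])"
  shows "\<exists>U. U \<in> carrier_mat n n \<and> mat_adjoint U * U = 1\<^sub>m n \<and>
    mat_adjoint U * A * U = mat_diag n (\<lambda>i. es ! i)"
  using assms
proof (induction es arbitrary: n A)
  case Nil
  then have "n = 0" using degree_monic_char_poly[of A n] by simp
  with Nil show ?case
    by (intro exI[of _ "1\<^sub>m n"]) (auto intro!: eq_matI simp: mat_diag_def)
next
  case (Cons e es)
  note A = Cons.prems(1) and herm = Cons.prems(2)
  have "eigenvalue A e"
    unfolding eigenvalue_root_char_poly[OF A] Cons.prems(3) by simp
  then obtain v where v: "v \<in> carrier_vec n" "v \<noteq> 0\<^sub>v n" and ev: "A *\<^sub>v v = e \<cdot>\<^sub>v v"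
    using A by (auto simp: eigenvalue_def eigenvector_def)
  have "n \<noteq> 0" using v by (auto simp: vec_eq_iff)
  then obtain k where n: "n = Suc k" by (cases n) auto
  obtain W c where W: "W \<in> carrier_mat n n" and WW: "mat_adjoint W * W = 1\<^sub>m n"
    and col0: "col W 0 = c \<cdot>\<^sub>v v"
    using unitary_with_first_column[OF v] by blast
  have WW': "W * mat_adjoint W = 1\<^sub>m n"
    using mat_mult_left_right_inverse[OF _ W WW] W by simp
  define A' where "A' = mat_adjoint W * A * W"
  have A': "A' \<in> carrier_mat n n" using A W by (simp add: A'_def square_mat_simps[where n = n])
  have A'herm: "mat_adjoint A' = A'"
    using A W herm by (simp add: A'_def square_mat_simps[where n = n])
  have "A *\<^sub>v col W 0 = e \<cdot>\<^sub>v col W 0"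
    using A v by (simp add: col0 ev mult_mat_vec smult_smult_assoc mult.commute)
  then have AW0: "col (A * W) 0 = e \<cdot>\<^sub>v col W 0"
    using col_mult2[OF A W, of 0] n by (metis zero_less_Suc)
  have A'col: "A' $$ (i, 0) = (if i = 0 then e else 0)" if "i < n" for i
  proof -
    have "A' $$ (i, 0) = row (mat_adjoint W) i \<bullet> col (A * W) 0"
      using that n A W unfolding A'_def by (simp add: square_mat_simps[where n = n])
    also have "\<dots> = e * (row (mat_adjoint W) i \<bullet> col W 0)"
      unfolding AW0 using W n by (simp add: scalar_prod_smult_distrib[of _ n])
    also have "row (mat_adjoint W) i \<bullet> col W 0 = (mat_adjoint W * W) $$ (i, 0)"
      using that n W by simp
    finally show ?thesis using that n unfolding WW by simp
  qed
  \<comment> \<open>Hermiticity carries the zeros of the first column over to the first row, which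
    makes \<open>A'\<close> block diagonal rather than merely block triangular.\<close>
  have A'row: "A' $$ (0, i) = 0" if "0 < i" "i < n" for i
  proof -
    have "A' $$ (0, i) = mat_adjoint A' $$ (0, i)" by (simp only: A'herm)
    also have "\<dots> = cnj (A' $$ (i, 0))" using that A' by simp
    finally show ?thesis using that A'col by simp
  qed
  define E where "E = mat 1 1 (\<lambda>_. e)"
  define A3 where "A3 = mat k k (\<lambda>(i, j). A' $$ (Suc i, Suc j))"
  have E: "E \<in> carrier_mat 1 1" and A3: "A3 \<in> carrier_mat k k" by (auto simp: E_def A3_def)
  have block: "A' = four_block_mat E (0\<^sub>m 1 k) (0\<^sub>m k 1) A3"
    using A' n A'col A'row by (intro eq_matI) (auto simp: E_def A3_def)
  have A3herm: "mat_adjoint A3 = A3"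
  proof (rule eq_matI)
    fix i j assume "i < dim_row A3" "j < dim_col A3"
    then have ij: "i < k" "j < k" using A3 by auto
    have "A' $$ (Suc i, Suc j) = mat_adjoint A' $$ (Suc i, Suc j)" by (simp only: A'herm)
    then show "mat_adjoint A3 $$ (i, j) = A3 $$ (i, j)" using ij A3 A' n by (simp add: A3_def)
  qed (use A3 in auto)
  have "similar_mat_wit A' A (mat_adjoint W) W"
    using A' A W WW WW' by (intro similar_mat_witI[of _ _ n]) (auto simp: A'_def square_mat_simps[where n = n])
  then have "char_poly A' = [:- e, 1:] * (\<Prod>e\<leftarrow>es. [:- e, 1:])"
    using char_poly_similar[of A' A] Cons.prems(3) by (auto simp: similar_mat_def)
  moreover have "char_poly A' = char_poly E * char_poly A3"
    unfolding block by (rule char_poly_four_block_zeros_col[OF E _ A3]) simp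
  moreover have "char_poly E = [:- e, 1:]"
    by (simp add: E_def char_poly_defs det_def sign_def)
  ultimately have "char_poly A3 = (\<Prod>e\<leftarrow>es. [:- e, 1:])"
    by (metis mult_cancel_left pCons_eq_0_iff zero_neq_one)
  from Cons.IH[OF A3 A3herm this] obtain U where U: "U \<in> carrier_mat k k"
    and UU: "mat_adjoint U * U = 1\<^sub>m k" and UA: "mat_adjoint U * A3 * U = mat_diag k (\<lambda>i. es ! i)"
    by blast
  \<comment> \<open>The unitary of the smaller block is extended by a corner entry 1;
    \<open>W * Q\<close> then diagonalizes \<open>A\<close>.\<close>
  define Q where "Q = four_block_mat (1\<^sub>m 1) (0\<^sub>m 1 k) (0\<^sub>m k 1) U"
  have Q: "Q \<in> carrier_mat n n" using U n by (auto simp: Q_def)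
  have adjQ: "mat_adjoint Q = four_block_mat (1\<^sub>m 1) (0\<^sub>m 1 k) (0\<^sub>m k 1) (mat_adjoint U)"
    using U by (intro eq_matI) (auto simp: Q_def)
  have adjU: "mat_adjoint U \<in> carrier_mat k k" using U by simp
  have QQ: "mat_adjoint Q * Q = 1\<^sub>m n"
    unfolding adjQ unfolding Q_def
    using U UU adjU n
    by (simp add: mult_block_diag[where p = 1 and q = k] plus_1_eq_Suc del: One_nat_def)
  have "mat_adjoint Q * A' = four_block_mat E (0\<^sub>m 1 k) (0\<^sub>m k 1) (mat_adjoint U * A3)"
    unfolding adjQ block using U adjU E A3
    by (simp add: mult_block_diag[where p = 1 and q = k] del: One_nat_def)
  then have "mat_adjoint Q * A' * Q
      = four_block_mat E (0\<^sub>m 1 k) (0\<^sub>m k 1) (mat_adjoint U * A3 * U)"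
    unfolding Q_def using U adjU E A3
    by (simp add: mult_block_diag[where p = 1 and q = k] mult_carrier_mat[of _ k k] del: One_nat_def)
  also have "\<dots> = mat_diag n (\<lambda>i. (e # es) ! i)"
    unfolding UA n by (intro eq_matI) (auto simp: mat_diag_def E_def nth_Cons')
  finally have QAQ: "mat_adjoint Q * A' * Q = mat_diag n (\<lambda>i. (e # es) ! i)" .
  have "mat_adjoint (W * Q) * (W * Q) = mat_adjoint Q * (mat_adjoint W * W) * Q"
    using W Q by (simp add: square_mat_simps[where n = n])
  also have "\<dots> = 1\<^sub>m n" using Q QQ by (simp add: WW)
  finally have 1: "mat_adjoint (W * Q) * (W * Q) = 1\<^sub>m n" .
  have "mat_adjoint (W * Q) * A * (W * Q) = mat_adjoint Q * A' * Q"
    using W Q A by (simp add: A'_def square_mat_simps[where n = n])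
  then show ?case using 1 QAQ W Q by (intro exI[of _ "W * Q"]) auto
qed

text \<open>A first diagonalization, along the chosen roots \<open>as\<close>, shows that they are
  real, so that taking real parts loses nothing. Sorting merely permutes the linear factors of the
  characteristic polynomial, and a second diagonalization along the sorted list gives
  \<open>U\<close>.\<close>

lemma eig_list_diagonalize:
  assumes A: "A \<in> carrier_mat n n" and herm: "mat_adjoint A = A"
  obtains U where "U \<in> carrier_mat n n" "mat_adjoint U * U = 1\<^sub>m n" "U * mat_adjoint U = 1\<^sub>m n"
    "mat_adjoint U * A * U = mat_diag n (\<lambda>i. of_real (eig_list A ! i))"
proof -
  define as where "as = (SOME as. char_poly A = (\<Prod>a\<leftarrow>as. [:- a, 1:]) \<and> length as = dim_row A)"
  have "char_poly A = (\<Prod>a\<leftarrow>as. [:- a, 1:]) \<and> length as = dim_row A"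
    unfolding as_def carrier_matD(1)[OF A] by (rule someI_ex[OF char_poly_factorized[OF A]])
  then have cp: "char_poly A = (\<Prod>a\<leftarrow>as. [:- a, 1:])" and len: "length as = n" using A by auto
  obtain V where V: "V \<in> carrier_mat n n" and D: "mat_adjoint V * A * V = mat_diag n (\<lambda>i. as ! i)"
    using hermitian_diagonalize[OF A herm cp] by blast
  have D_herm: "mat_adjoint (mat_diag n (\<lambda>i. as ! i)) = mat_diag n (\<lambda>i. as ! i)"
    unfolding D[symmetric] using A V herm by (simp add: square_mat_simps[where n = n])
  have "of_real (Re (as ! i)) = as ! i" if i: "i < n" for i
  proof -
    have "mat_adjoint (mat_diag n (\<lambda>i. as ! i)) $$ (i, i) = as ! i"
      unfolding D_herm using i by (simp add: mat_diag_def)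
    then show ?thesis using i by (simp add: mat_diag_def complex_eq_iff)
  qed
  then have real: "map (\<lambda>a. of_real (Re a)) as = as"
    using len by (intro nth_equalityI) auto
  define es where "es = map complex_of_real (eig_list A)"
  have "mset es = mset (map (\<lambda>a. of_real (Re a)) as)"
    by (simp add: es_def eig_list_def flip: as_def) (simp add: image_mset.compositionality comp_def)
  then have "mset es = mset as" unfolding real .
  then have "(\<Prod>e\<leftarrow>es. [:- e, 1:]) = (\<Prod>a\<leftarrow>as. [:- a, 1:])"
    by (metis mset_map prod_mset_prod_list)
  then obtain U where U: "U \<in> carrier_mat n n" "mat_adjoint U * U = 1\<^sub>m n"
    and UA: "mat_adjoint U * A * U = mat_diag n (\<lambda>i. es ! i)"
    using hermitian_diagonalize[OF A herm, of es] cp by auto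
  have "length es = n" using \<open>mset es = mset as\<close> len by (metis size_mset)
  then have "mat_diag n (\<lambda>i. es ! i) = mat_diag n (\<lambda>i. of_real (eig_list A ! i))"
    by (intro eq_matI) (auto simp: mat_diag_def es_def)
  moreover have "U * mat_adjoint U = 1\<^sub>m n"
    using mat_mult_left_right_inverse[OF _ U(1,2)] U(1) by simp
  ultimately show ?thesis using that U UA by simp
qed

lemma length_eig_list:
  assumes A: "A \<in> carrier_mat n n"
  shows "length (eig_list A) = n"
  using someI_ex[OF char_poly_factorized[OF A]]
  by (simp add: eig_list_def carrier_matD(1)[OF A])

lemma eig_list_antimono:
  assumes "A \<in> carrier_mat n n" "i \<le> j" "j < n"
  shows "eig_list A ! j \<le> eig_list A ! i"
  using assms length_eig_list[OF assms(1)]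
  by (intro sorted_rev_nth_mono) (auto simp: eig_list_def)

section \<open>Positive definite matrices and the geometric mean\<close>

lemma cscalar_prod_adjoint:
  fixes X :: "complex mat"
  assumes X: "X \<in> carrier_mat n m" and w: "w \<in> carrier_vec n" and v: "v \<in> carrier_vec m"
  shows "(mat_adjoint X *\<^sub>v w) \<bullet>c v = w \<bullet>c (X *\<^sub>v v)"
proof -
  have "(mat_adjoint X *\<^sub>v w) \<bullet>c v
      = (\<Sum>i = 0..<m. \<Sum>l = 0..<n. cnj (X $$ (l, i)) * w $ l * cnj (v $ i))"
    using assms by (auto simp: scalar_prod_def sum_distrib_right intro!: sum.cong)
  also have "\<dots> = (\<Sum>l = 0..<n. \<Sum>i = 0..<m. cnj (X $$ (l, i)) * w $ l * cnj (v $ i))"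
    by (rule sum.swap)
  also have "\<dots> = w \<bullet>c (X *\<^sub>v v)"
    using assms by (auto simp: scalar_prod_def sum_distrib_left mult_ac intro!: sum.cong)
  finally show ?thesis .
qed

text \<open>The quadratic form at \<open>v\<close> is that of \<open>P\<close> at
  \<open>X v\<close>, and the left inverse \<open>Y\<close> keeps \<open>X v\<close> from
  vanishing.\<close>

lemma pos_def_congruence:
  assumes P: "P \<in> carrier_mat n n" "pos_def_mat P"
    and X: "X \<in> carrier_mat n n" and Y: "Y \<in> carrier_mat n n" "Y * X = 1\<^sub>m n"
  shows "pos_def_mat (mat_adjoint X * P * X)"
proof -
  have herm: "mat_adjoint P = P" using P by (simp add: pos_def_mat_def hermitian_mat_def)
  have carr: "mat_adjoint X * P * X \<in> carrier_mat n n"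
    using P X by (simp add: square_mat_simps[where n = n])
  have "mat_adjoint (mat_adjoint X * P * X) = mat_adjoint X * P * X"
    using P X herm by (simp add: square_mat_simps[where n = n])
  moreover have "0 < Re ((mat_adjoint X * P * X *\<^sub>v v) \<bullet>c v)"
    if v: "v \<in> carrier_vec n" "v \<noteq> 0\<^sub>v n" for v
  proof -
    have Xv: "X *\<^sub>v v \<in> carrier_vec n" using X v by simp
    have "X *\<^sub>v v \<noteq> 0\<^sub>v n"
    proof
      assume 0: "X *\<^sub>v v = 0\<^sub>v n"
      have "v = (Y * X) *\<^sub>v v" using Y v by simp
      also have "\<dots> = Y *\<^sub>v (X *\<^sub>v v)" using X Y v by (intro assoc_mult_mat_vec[of _ n n _ n]) auto
      also have "\<dots> = 0\<^sub>v n" unfolding 0 using Y by (intro eq_vecI) (auto simp: scalar_prod_def)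
      finally show False using v by simp
    qed
    then have "0 < Re ((P *\<^sub>v (X *\<^sub>v v)) \<bullet>c (X *\<^sub>v v))"
      using P Xv by (auto simp: pos_def_mat_def)
    also have "(P *\<^sub>v (X *\<^sub>v v)) \<bullet>c (X *\<^sub>v v) = (mat_adjoint X *\<^sub>v (P *\<^sub>v (X *\<^sub>v v))) \<bullet>c v"
      using X P v Xv by (intro cscalar_prod_adjoint[symmetric, of _ n n]) auto
    also have "mat_adjoint X *\<^sub>v (P *\<^sub>v (X *\<^sub>v v)) = mat_adjoint X * P * X *\<^sub>v v"
      using X P v Xv
      by (simp add: assoc_mult_mat_vec[of _ n n _ n] mult_carrier_mat[of _ n n _ n])
    finally show ?thesis .
  qed
  ultimately show ?thesis using carr by (auto simp: pos_def_mat_def hermitian_mat_def)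
qed

lemma pos_def_diag:
  assumes d: "\<And>i. i < n \<Longrightarrow> 0 < d i"
  shows "pos_def_mat (mat_diag n (\<lambda>i. complex_of_real (d i)))"
proof -
  let ?D = "mat_diag n (\<lambda>i. complex_of_real (d i))"
  have "0 < Re ((?D *\<^sub>v v) \<bullet>c v)" if v: "v \<in> carrier_vec n" "v \<noteq> 0\<^sub>v n" for v
  proof -
    have "(?D *\<^sub>v v) $ i = of_real (d i) * v $ i" if "i < n" for i
    proof -
      have "(?D *\<^sub>v v) $ i = (\<Sum>j = 0..<n. if j = i then of_real (d i) * v $ i else 0)"
        using that v by (simp add: mat_diag_def scalar_prod_def del: sum.delta sum.delta') (rule sum.cong, auto)
      then show ?thesis using that by simp
    qed
    then have "(?D *\<^sub>v v) \<bullet>c v = (\<Sum>i = 0..<n. of_real (d i) * (v $ i * cnj (v $ i)))"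
      using v by (auto simp: scalar_prod_def mult_ac intro!: sum.cong)
    also have "\<dots> = of_real (\<Sum>i = 0..<n. d i * (cmod (v $ i))\<^sup>2)"
      by (simp add: complex_norm_square[symmetric])
    finally have eq: "Re ((?D *\<^sub>v v) \<bullet>c v) = (\<Sum>i = 0..<n. d i * (cmod (v $ i))\<^sup>2)" by simp
    obtain j where "j < n" "v $ j \<noteq> 0"
      using v by (auto simp: vec_eq_iff)
    then show ?thesis
      unfolding eq using d by (intro sum_pos2[of _ j]) (auto intro!: mult_nonneg_nonneg mult_pos_pos simp: less_imp_le)
  qed
  moreover have "dim_row ?D = n" "dim_col ?D = n" by (auto simp: mat_diag_def)
  ultimately show ?thesis
    using adjoint_diag[of n d] by (auto simp: pos_def_mat_def hermitian_mat_def)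
qed

lemma pos_def_diag_entry:
  assumes P: "P \<in> carrier_mat n n" "pos_def_mat P" and i: "i < n"
  shows "0 < Re (P $$ (i, i))"
proof -
  have "(P *\<^sub>v unit_vec n i) \<bullet>c unit_vec n i = P $$ (i, i)"
  proof -
    have "conjugate (unit_vec n i) = (unit_vec n i :: complex vec)"
      by (intro eq_vecI) (auto simp: unit_vec_def)
    then show ?thesis using P i by (simp add: scalar_prod_right_unit[of _ n])
  qed
  moreover have "unit_vec n i \<noteq> (0\<^sub>v n :: complex vec)" using i by simp
  ultimately show ?thesis using P by (auto simp: pos_def_mat_def)
qed

lemma pos_def_unitary_conjugate:
  assumes "P \<in> carrier_mat n n" "pos_def_mat P" "U \<in> carrier_mat n n" "mat_adjoint U * U = 1\<^sub>m n"
  shows "pos_def_mat (mat_adjoint U * P * U)"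
  using assms by (intro pos_def_congruence[of _ n _ "mat_adjoint U"]) auto

lemma pos_def_adjoint: "pos_def_mat P \<Longrightarrow> mat_adjoint P = P"
  by (simp add: pos_def_mat_def hermitian_mat_def)

lemma eig_list_pos:
  assumes A: "A \<in> carrier_mat n n" "pos_def_mat A" and i: "i < n"
  shows "0 < eig_list A ! i"
proof -
  obtain U where U: "U \<in> carrier_mat n n" "mat_adjoint U * U = 1\<^sub>m n" "U * mat_adjoint U = 1\<^sub>m n"
    and D: "mat_adjoint U * A * U = mat_diag n (\<lambda>i. of_real (eig_list A ! i))"
    by (rule eig_list_diagonalize[OF A(1) pos_def_adjoint[OF A(2)]])
  have "0 < Re ((mat_adjoint U * A * U) $$ (i, i))"
    using A U i by (intro pos_def_diag_entry[of _ n] pos_def_unitary_conjugate[of _ n])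
      (auto simp: square_mat_simps[where n = n])
  then show ?thesis using i by (simp add: D mat_diag_def)
qed

text \<open>With \<open>D = B - C\<close> we have \<open>B D + D C = 0\<close>; in an eigenbasis of \<open>D\<close> the diagonal of this
  identity says that every eigenvalue of \<open>D\<close> vanishes.\<close>

lemma pos_def_sqrt_unique:
  assumes B: "B \<in> carrier_mat n n" "pos_def_mat B" and C: "C \<in> carrier_mat n n" "pos_def_mat C"
    and eq: "B * B = C * C"
  shows "B = C"
proof -
  define D where "D = B - C"
  have D: "D \<in> carrier_mat n n" using B C by (auto simp: D_def intro!: minus_carrier_mat)
  have D_herm: "mat_adjoint D = D"
  proof (rule eq_matI)
    fix i j assume "i < dim_row D" "j < dim_col D"
    then have ij: "i < n" "j < n" using D by auto
    have "mat_adjoint B $$ (i, j) = B $$ (i, j)" "mat_adjoint C $$ (i, j) = C $$ (i, j)"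
      using pos_def_adjoint[OF B(2)] pos_def_adjoint[OF C(2)] by simp_all
    then show "mat_adjoint D $$ (i, j) = D $$ (i, j)" using ij B C by (simp add: D_def)
  qed (use D in auto)
  have sylvester: "B * D + D * C = 0\<^sub>m n n"
  proof -
    have "B * D = B * B - B * C" "D * C = B * C - C * C"
      using B C by (simp_all add: D_def mult_minus_distrib_mat[of _ n n] minus_mult_distrib_mat[of _ n n])
    then show ?thesis using B C unfolding eq by (intro eq_matI) auto
  qed
  obtain U where U: "U \<in> carrier_mat n n" "mat_adjoint U * U = 1\<^sub>m n" "U * mat_adjoint U = 1\<^sub>m n"
    and UD: "mat_adjoint U * D * U = mat_diag n (\<lambda>i. of_real (eig_list D ! i))"
    by (rule eig_list_diagonalize[OF D D_herm])
  let ?E = "mat_diag n (\<lambda>i. complex_of_real (eig_list D ! i))"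
  define B' where "B' = mat_adjoint U * B * U"
  define C' where "C' = mat_adjoint U * C * U"
  have U': "mat_adjoint U \<in> carrier_mat n n" using U by simp
  have B': "B' \<in> carrier_mat n n" and C': "C' \<in> carrier_mat n n"
    using B C U by (auto simp: B'_def C'_def square_mat_simps[where n = n])
  have cancel: "U * (mat_adjoint U * X) = X" if "X \<in> carrier_mat n n" for X
    using U U' that by (simp flip: assoc_mult_mat[of _ n n _ n _ n])
  have "B' * ?E + ?E * C' = mat_adjoint U * (B * D + D * C) * U"
    unfolding UD[symmetric] B'_def C'_def using B C D U U'
    by (simp add: square_mat_simps[where n = n] cancel mult_add_distrib_mat[of _ n n _ n]
      add_mult_distrib_mat[of _ n n _ _ n])
  also have "\<dots> = 0\<^sub>m n n" unfolding sylvester using U U' by simp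
  finally have zero: "B' * ?E + ?E * C' = 0\<^sub>m n n" .
  \<comment> \<open>The diagonal entries of \<open>B'\<close> and \<open>C'\<close> have positive
    real parts, so the other factor of the \<open>i\<close>-th diagonal entry must vanish.\<close>
  have "eig_list D ! i = 0" if i: "i < n" for i
  proof -
    have "0 = (B' * ?E + ?E * C') $$ (i, i)" unfolding zero using i by simp
    also have "\<dots> = of_real (eig_list D ! i) * (B' $$ (i, i) + C' $$ (i, i))"
      using i B' C' by (simp add: mat_diag_mult_left[of _ n n] mat_diag_mult_right[of _ n n] algebra_simps)
    finally have "0 = of_real (eig_list D ! i) * (B' $$ (i, i) + C' $$ (i, i))" .
    from arg_cong[OF this, of Re]
    have "eig_list D ! i * (Re (B' $$ (i, i)) + Re (C' $$ (i, i))) = 0" by simp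
    moreover have "0 < Re (B' $$ (i, i))" "0 < Re (C' $$ (i, i))"
      using pos_def_unitary_conjugate[OF B U(1,2)] pos_def_unitary_conjugate[OF C U(1,2)]
        pos_def_diag_entry[OF B' _ i] pos_def_diag_entry[OF C' _ i]
      by (simp_all add: B'_def C'_def)
    ultimately show ?thesis by simp
  qed
  then have E0: "?E = 0\<^sub>m n n" by (intro eq_matI) (auto simp: mat_diag_def)
  have "D = U * (mat_adjoint U * D * U) * mat_adjoint U"
    using U U' D cancel[of D] by (simp add: square_mat_simps[where n = n])
  also have "\<dots> = 0\<^sub>m n n" unfolding UD E0 using U U' by simp
  finally have "B - C = 0\<^sub>m n n" by (simp add: D_def)
  show ?thesis
  proof (rule eq_matI)
    fix i j assume "i < dim_row C" "j < dim_col C"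
    then have "(B - C) $$ (i, j) = 0" using \<open>B - C = _\<close> C by simp
    then show "B $$ (i, j) = C $$ (i, j)" using \<open>i < dim_row C\<close> \<open>j < dim_col C\<close> by simp
  qed (use B C in auto)
qed

section \<open>Existence of square roots, inverses and the geometric mean\<close>

lemma pos_def_sqrt_exists:
  assumes A: "A \<in> carrier_mat n n" "pos_def_mat A"
  shows "\<exists>R. R \<in> carrier_mat n n \<and> pos_def_mat R \<and> R * R = A"
proof -
  obtain U where U: "U \<in> carrier_mat n n" "mat_adjoint U * U = 1\<^sub>m n" "U * mat_adjoint U = 1\<^sub>m n"
    and D: "mat_adjoint U * A * U = mat_diag n (\<lambda>i. of_real (eig_list A ! i))"
    by (rule eig_list_diagonalize[OF A(1) pos_def_adjoint[OF A(2)]])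
  let ?E = "mat_diag n (\<lambda>i. complex_of_real (sqrt (eig_list A ! i)))"
  define R where "R = U * ?E * mat_adjoint U"
  have U': "mat_adjoint U \<in> carrier_mat n n" using U by simp
  have E: "?E \<in> carrier_mat n n" by simp
  have cancel: "U * (mat_adjoint U * X) = X" "mat_adjoint U * (U * X) = X"
    if "X \<in> carrier_mat n n" for X
    using U U' that by (simp_all flip: assoc_mult_mat[of _ n n _ n _ n])
  have R: "R \<in> carrier_mat n n" using U U' E by (simp add: R_def square_mat_simps[where n = n])
  have "pos_def_mat ?E" using A by (intro pos_def_diag) (auto intro: eig_list_pos)
  then have "pos_def_mat (mat_adjoint (mat_adjoint U) * ?E * mat_adjoint U)"
    using U U' E by (intro pos_def_congruence[of _ n _ U]) auto
  then have "pos_def_mat R" by (simp add: R_def)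
  have EE: "?E * ?E = mat_adjoint U * A * U"
    unfolding D mat_diag_diag using A
    by (auto intro!: eq_matI simp: mat_diag_def less_imp_le[OF eig_list_pos] simp flip: of_real_mult)
  have "R * R = U * (?E * ?E) * mat_adjoint U"
    using U U' E cancel by (simp add: R_def square_mat_simps[where n = n] del: mat_diag_diag)
  also have "\<dots> = A"
    unfolding EE using U U' A cancel by (simp add: square_mat_simps[where n = n])
  finally show ?thesis using R \<open>pos_def_mat R\<close> by blast
qed

text \<open>Existence and uniqueness together release the definite description behind
  \<open>mat_sqrt\<close>.\<close>

lemma mat_sqrt_pos_def:
  assumes A: "A \<in> carrier_mat n n" "pos_def_mat A"
  shows "mat_sqrt A \<in> carrier_mat n n" "pos_def_mat (mat_sqrt A)" "mat_sqrt A * mat_sqrt A = A"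
proof -
  let ?P = "\<lambda>R. R \<in> carrier_mat (dim_row A) (dim_row A) \<and> pos_def_mat R \<and> R * R = A"
  have "\<exists>!R. ?P R"
    using pos_def_sqrt_exists[OF A] A(1) pos_def_sqrt_unique[of _ n] by (metis carrier_matD(1))
  then have "?P (mat_sqrt A)" unfolding mat_sqrt_def by (rule theI')
  then show "mat_sqrt A \<in> carrier_mat n n" "pos_def_mat (mat_sqrt A)" "mat_sqrt A * mat_sqrt A = A"
    using A by auto
qed

lemma mat_inv_pos_def:
  assumes S: "S \<in> carrier_mat n n" "pos_def_mat S"
  shows "mat_inv S \<in> carrier_mat n n" "S * mat_inv S = 1\<^sub>m n" "mat_inv S * S = 1\<^sub>m n"
    "mat_adjoint (mat_inv S) = mat_inv S"
proof -
  have "det S \<noteq> 0"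
  proof
    assume "det S = 0"
    then obtain v where "v \<in> carrier_vec n" "v \<noteq> 0\<^sub>v n" "S *\<^sub>v v = 0\<^sub>v n"
      using det_0_iff_vec_prod_zero[OF S(1)] by blast
    moreover have "0\<^sub>v n \<bullet>c v = 0" if "v \<in> carrier_vec n" for v :: "complex vec"
      using that by (simp add: scalar_prod_def)
    ultimately show False using S by (force simp: pos_def_mat_def)
  qed
  from det_non_zero_imp_unit[OF S(1) this, of "()"]
  obtain Y where Y: "Y \<in> carrier_mat n n" "S * Y = 1\<^sub>m n" "Y * S = 1\<^sub>m n"
    by (auto simp: Units_def ring_mat_def)
  have unique: "Z = Y" if "Z \<in> carrier_mat n n" "S * Z = 1\<^sub>m n" for Z
  proof -
    have "Z = (Y * S) * Z" using Y that by simp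
    also have "\<dots> = Y * (S * Z)" using Y S that by (intro assoc_mult_mat[of _ n n _ n _ n]) auto
    finally show ?thesis using Y that by simp
  qed
  have inv_eq: "mat_inv S = Y"
    unfolding mat_inv_def carrier_matD(1)[OF S(1)] using Y unique by blast
  then show "mat_inv S \<in> carrier_mat n n" "S * mat_inv S = 1\<^sub>m n" "mat_inv S * S = 1\<^sub>m n"
    using Y by auto
  \<comment> \<open>As \<open>S\<close> is Hermitian, the adjoint of its inverse is again a right
    inverse, so uniqueness makes the inverse Hermitian.\<close>
  have "S * mat_adjoint Y = mat_adjoint (Y * S)"
    using adjoint_mult[OF Y(1) S(1)] pos_def_adjoint[OF S(2)] by simp
  then have "mat_adjoint Y = Y" using Y by (intro unique) auto
  then show "mat_adjoint (mat_inv S) = mat_inv S" by (simp add: inv_eq)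
qed

text \<open>Roots and inverses disappear from the later argument, which sees only Hermitian factors
  \<open>S\<close> and \<open>M\<close>. Products are bracketed to the right, as the associativity
  rewriting produces them.\<close>

lemma geo_mean_factorization:
  assumes A: "A \<in> carrier_mat n n" "pos_def_mat A" and B: "B \<in> carrier_mat n n" "pos_def_mat B"
  obtains S M where "S \<in> carrier_mat n n" "M \<in> carrier_mat n n"
    "mat_adjoint S = S" "mat_adjoint M = M" "A = S * S" "B = S * (M * (M * S))"
    "geo_mean A B = S * (M * S)" "pos_def_mat (geo_mean A B)"
proof -
  define S where "S = mat_sqrt A"
  define T where "T = mat_inv S"
  define M where "M = mat_sqrt (T * B * T)"
  note S = mat_sqrt_pos_def[OF A, folded S_def]
  note T = mat_inv_pos_def[OF S(1,2), folded T_def]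
  have TBT: "T * B * T \<in> carrier_mat n n" using T B by (simp add: square_mat_simps[where n = n])
  have "pos_def_mat (mat_adjoint T * B * T)"
    using B T S by (intro pos_def_congruence[of _ n _ S]) auto
  then have "pos_def_mat (T * B * T)" using T by simp
  note M = mat_sqrt_pos_def[OF TBT this, folded M_def]
  have S_adj: "mat_adjoint S = S" using S by (intro pos_def_adjoint)
  have cancel: "S * (T * X) = X" if "X \<in> carrier_mat n n" for X
    using T S that by (simp flip: assoc_mult_mat[of _ n n _ n _ n])
  have G: "geo_mean A B = S * M * S" by (simp add: geo_mean_def Let_def S_def T_def M_def)
  \<comment> \<open>Since \<open>M * M = T * B * T\<close> and \<open>T\<close> inverts
    \<open>S\<close>, the outer factors cancel and \<open>B\<close> remains.\<close>
  have "S * (M * (M * S)) = S * (M * M) * S"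
    using S(1) M(1) by (simp add: square_mat_simps[where n = n])
  also have "\<dots> = B"
    unfolding M(3) using S T B cancel by (simp add: square_mat_simps[where n = n])
  finally have B_eq: "B = S * (M * (M * S))" ..
  have "pos_def_mat (mat_adjoint S * M * S)"
    using S M T by (intro pos_def_congruence[of _ n _ T]) auto
  then have "pos_def_mat (geo_mean A B)" unfolding G S_adj .
  moreover have "geo_mean A B = S * (M * S)"
    unfolding G using S(1) M(1) by (simp add: square_mat_simps[where n = n])
  ultimately show ?thesis
    using that[OF S(1) M(1) S_adj pos_def_adjoint[OF M(2)] S(3)[symmetric] B_eq] by blast
qed

lemma geo_mean_carrier:
  assumes "A \<in> carrier_mat n n" "pos_def_mat A" "B \<in> carrier_mat n n" "pos_def_mat B"
  shows "geo_mean A B \<in> carrier_mat n n"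
  by (rule geo_mean_factorization[OF assms]) (simp add: mult_carrier_mat[of _ n n])

lemma geo_mean_pos_def:
  assumes "A \<in> carrier_mat n n" "pos_def_mat A" "B \<in> carrier_mat n n" "pos_def_mat B"
  shows "pos_def_mat (geo_mean A B)"
  by (rule geo_mean_factorization[OF assms])

section \<open>Compressions and log-majorization for the geometric mean\<close>

lemma det_compression_le:
  assumes A: "A \<in> carrier_mat n n" "pos_def_mat A"
    and V: "V \<in> carrier_mat n m" "mat_adjoint V * V = 1\<^sub>m m"
  shows "Re (det (mat_adjoint V * (A * V))) \<le> (\<Prod>i<m. eig_list A ! i)"
proof -
  obtain U where U: "U \<in> carrier_mat n n" "mat_adjoint U * U = 1\<^sub>m n" "U * mat_adjoint U = 1\<^sub>m n"
    and D: "mat_adjoint U * A * U = mat_diag n (\<lambda>i. of_real (eig_list A ! i))"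
    by (rule eig_list_diagonalize[OF A(1) pos_def_adjoint[OF A(2)]])
  \<comment> \<open>\<open>W\<close> is \<open>V\<close> expressed in an eigenbasis of
    \<open>A\<close>: still an isometry, while \<open>A\<close> becomes diagonal with decreasing
    entries.\<close>
  define W where "W = mat_adjoint U * V"
  have U': "mat_adjoint U \<in> carrier_mat n n" and V': "mat_adjoint V \<in> carrier_mat m n"
    using U V by auto
  have W: "W \<in> carrier_mat n m" using U' V by (simp add: W_def mult_carrier_mat[of _ n n])
  have adjW: "mat_adjoint W = mat_adjoint V * U"
    using U V by (simp add: W_def adjoint_mult[of _ n n _ m])
  have cancel: "U * (mat_adjoint U * X) = X" if "X \<in> carrier_mat n m" for X
    using U U' that by (simp flip: assoc_mult_mat[of _ n n _ n _ m])
  note simps = mult_carrier_mat[of _ n n _ m] mult_carrier_mat[of _ n n _ n]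
    assoc_mult_mat[of _ m n _ n _ m] assoc_mult_mat[of _ n n _ n _ m] assoc_mult_mat[of _ n n _ n _ n]
  have iso: "mat_adjoint W * W = 1\<^sub>m m"
    unfolding adjW unfolding W_def using U U' V V' by (simp add: simps cancel)
  have "mat_adjoint W * (mat_adjoint U * A * U * W) = mat_adjoint V * (A * V)"
    unfolding adjW unfolding W_def using U U' V V' A by (simp add: simps cancel)
  moreover have "Re (det (mat_adjoint W * (mat_adjoint U * A * U * W))) \<le> (\<Prod>i<m. eig_list A ! i)"
    unfolding D using A
    by (intro det_compression_diag_le[OF W iso] eig_list_pos eig_list_antimono) auto
  ultimately show ?thesis by simp
qed

lemma det_diag: "det (mat_diag m d) = (\<Prod>i<m. d i :: 'a :: idom)"
proof -
  have "det (mat_diag m d) = prod_list (diag_mat (mat_diag m d))"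
    by (rule det_upper_triangular[of _ m]) (auto simp: mat_diag_def)
  also have "diag_mat (mat_diag m d) = map d [0..<m]"
    by (auto simp: diag_mat_def mat_diag_def)
  also have "prod_list \<dots> = (\<Prod>i<m. d i)"
    by (subst prod.distinct_set_conv_list[symmetric]) (auto simp: lessThan_atLeast0)
  finally show ?thesis .
qed

lemma geo_mean_log_majorization:
  assumes A: "A \<in> carrier_mat n n" "pos_def_mat A" and B: "B \<in> carrier_mat n n" "pos_def_mat B"
    and m: "m \<le> n"
  shows "(\<Prod>i<m. eig_list (geo_mean A B) ! i)\<^sup>2 \<le> (\<Prod>i<m. eig_list A ! i) * (\<Prod>i<m. eig_list B ! i)"
proof -
  define G where "G = geo_mean A B"
  obtain S M where S: "S \<in> carrier_mat n n" and M: "M \<in> carrier_mat n n"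
    and adj: "mat_adjoint S = S" "mat_adjoint M = M"
    and AS: "A = S * S" and BS: "B = S * (M * (M * S))"
    and GS: "G = S * (M * S)" and G_pos: "pos_def_mat G"
    unfolding G_def by (rule geo_mean_factorization[OF A B])
  have G: "G \<in> carrier_mat n n" using S M by (simp add: GS square_mat_simps[where n = n])
  obtain U where U: "U \<in> carrier_mat n n" "mat_adjoint U * U = 1\<^sub>m n" "U * mat_adjoint U = 1\<^sub>m n"
    and UG: "mat_adjoint U * G * U = mat_diag n (\<lambda>i. of_real (eig_list G ! i))"
    by (rule eig_list_diagonalize[OF G pos_def_adjoint[OF G_pos]])
  \<comment> \<open>The first \<open>m\<close> columns of \<open>U\<close> belong to the
    \<open>m\<close> largest eigenvalues of \<open>G\<close>, as \<open>eig_list\<close> is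
    non-increasing.\<close>
  define V where "V = mat n m (\<lambda>(i, j). U $$ (i, j))"
  have V: "V \<in> carrier_mat n m" by (simp add: V_def)
  \<comment> \<open>The compression by \<open>V\<close> is the leading block of the one by
    \<open>U\<close>. Taking \<open>P\<close> to be the identity gives the isometry, and taking
    \<open>P = G\<close> gives the diagonal form.\<close>
  have compress: "(mat_adjoint V * (P * V)) $$ (i, j) = (mat_adjoint U * (P * U)) $$ (i, j)"
    if "i < m" "j < m" "P \<in> carrier_mat n n" for P i j
  proof -
    have "col V j = col U j" using that m U by (intro eq_vecI) (auto simp: V_def)
    moreover have "row (mat_adjoint V) i = row (mat_adjoint U) i"
      using that m U by (intro eq_vecI) (auto simp: V_def)
    moreover have "col (P * V) j = P *\<^sub>v col V j" "col (P * U) j = P *\<^sub>v col U j"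
      using that m U V by (auto intro!: col_mult2[of _ n n _ m] col_mult2[of _ n n _ n])
    ultimately show ?thesis
      using that m U V by (simp del: col_mult2)
  qed
  have iso: "mat_adjoint V * V = 1\<^sub>m m"
    using compress[of _ _ "1\<^sub>m n"] U V m by (intro eq_matI) auto
  have "mat_adjoint V * (G * V) = mat_diag m (\<lambda>i. of_real (eig_list G ! i))"
  proof (rule eq_matI)
    fix i j assume "i < dim_row (mat_diag m (\<lambda>i. complex_of_real (eig_list G ! i)))"
      "j < dim_col (mat_diag m (\<lambda>i. complex_of_real (eig_list G ! i)))"
    then have ij: "i < m" "j < m" by (auto simp: mat_diag_def)
    have "(mat_adjoint V * (G * V)) $$ (i, j) = (mat_adjoint U * G * U) $$ (i, j)"
      using compress[OF ij G] G U by (simp add: assoc_mult_mat[of _ n n _ n _ n])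
    then show "(mat_adjoint V * (G * V)) $$ (i, j) = mat_diag m (\<lambda>i. of_real (eig_list G ! i)) $$ (i, j)"
      unfolding UG using ij m by (simp add: mat_diag_def)
  qed (use V in \<open>auto simp: mat_diag_def\<close>)
  then have detG: "det (mat_adjoint V * (G * V)) = of_real (\<Prod>i<m. eig_list G ! i)"
    by (simp add: det_diag)
  define X where "X = S * V"
  define Y where "Y = M * X"
  have X: "X \<in> carrier_mat n m" using S V by (simp add: X_def mult_carrier_mat[of _ n n])
  have Y: "Y \<in> carrier_mat n m" using M X by (simp add: Y_def mult_carrier_mat[of _ n n])
  have V': "mat_adjoint V \<in> carrier_mat m n" using V by simp
  note simps = mult_carrier_mat[of _ n n _ m] mult_carrier_mat[of _ n n _ n] mult_carrier_mat[of _ m n _ n]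
    assoc_mult_mat[of _ m n _ n _ m] assoc_mult_mat[of _ n n _ n _ m] assoc_mult_mat[of _ n n _ n _ n]
    assoc_mult_mat[of _ m n _ n _ n] adjoint_mult[of _ n n _ m]
  have XY: "mat_adjoint X * Y = mat_adjoint V * (G * V)"
    unfolding GS using S M V V' by (simp add: X_def Y_def simps adj)
  have XX: "mat_adjoint X * X = mat_adjoint V * (A * V)"
    unfolding AS using S V V' by (simp add: X_def simps adj)
  have YY: "mat_adjoint Y * Y = mat_adjoint V * (B * V)"
    unfolding BS using S M V V' by (simp add: X_def Y_def simps adj)
  have "(\<Prod>i<m. eig_list G ! i)\<^sup>2 = (cmod (det (mat_adjoint X * Y)))\<^sup>2"
    unfolding XY detG norm_of_real by simp
  also have "\<dots> \<le> Re (det (mat_adjoint X * X)) * Re (det (mat_adjoint Y * Y))"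
    by (rule det_cauchy_schwarz[OF X Y])
  also have "\<dots> \<le> (\<Prod>i<m. eig_list A ! i) * (\<Prod>i<m. eig_list B ! i)"
  proof (rule mult_mono)
    show "Re (det (mat_adjoint X * X)) \<le> (\<Prod>i<m. eig_list A ! i)"
      unfolding XX by (rule det_compression_le[OF A V iso])
    show "Re (det (mat_adjoint Y * Y)) \<le> (\<Prod>i<m. eig_list B ! i)"
      unfolding YY by (rule det_compression_le[OF B V iso])
    show "0 \<le> (\<Prod>i<m. eig_list A ! i)"
      using m by (intro prod_nonneg) (auto intro!: less_imp_le eig_list_pos[OF A])
    show "0 \<le> Re (det (mat_adjoint Y * Y))" by (rule det_gram_nonneg[OF Y])
  qed
  finally show ?thesis unfolding G_def .
qed

theorem theorem18:
  fixes a :: "nat \<Rightarrow> real" and n k :: nat and A B :: "complex mat"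
  assumes a_nonneg: "\<And>j. 0 \<le> a j"
    and k: "1 \<le> k" "k \<le> n"
    and A: "A \<in> carrier_mat n n" "pos_def_mat A"
      "\<forall>x \<in> set (eig_list A). 0 < x \<and> ereal x < conv_radius a"
    and B: "B \<in> carrier_mat n n" "pos_def_mat B"
      "\<forall>x \<in> set (eig_list B). 0 < x \<and> ereal x < conv_radius a"
  shows "phi_k a k (geo_mean A B) \<le> sqrt (phi_k a k A * phi_k a k B)"
proof -
  note G = geo_mean_carrier[OF A(1,2) B(1,2)] and G_pos = geo_mean_pos_def[OF A(1,2) B(1,2)]
  show ?thesis
    unfolding phi_k_def
  proof (rule prod_pser_le_sqrt[OF a_nonneg k(1)])
    fix i assume i: "i < k"
    show "0 < eig_list (geo_mean A B) ! i" using i k by (intro eig_list_pos[OF G G_pos]) simp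
    show "0 < eig_list A ! i \<and> ereal (eig_list A ! i) < conv_radius a"
      "0 < eig_list B ! i \<and> ereal (eig_list B ! i) < conv_radius a"
      using i k A B by (auto simp: length_eig_list)
  next
    fix i assume "Suc i < k"
    then show "eig_list (geo_mean A B) ! Suc i \<le> eig_list (geo_mean A B) ! i"
      using k by (intro eig_list_antimono[OF G]) auto
  next
    fix m assume "m \<le> k"
    then show "(\<Prod>i<m. eig_list (geo_mean A B) ! i)\<^sup>2
        \<le> (\<Prod>i<m. eig_list A ! i) * (\<Prod>i<m. eig_list B ! i)"
      using k by (intro geo_mean_log_majorization[OF A(1,2) B(1,2)]) simp
  qed
qed

end
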